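(* Let $(C_*,\partial_* )$ be a finitely generated chain complex over a field $\mathbb{K}$ (with differential raising the degree by one). For each $i$, denote by $B_i=\{b_i^j\}_{j=1,\dots,k_i}$ a basis for $C_i$ as a $\mathbb{K}$-vector space. Assume there exists a matching $M$ on $(C_*,\partial_* )$, partitioned into acyclic sub-matchings $M_1,\dots,M_k$, and a function $\varphi\colon\bigcup_i B_i\to\mathbb{N}$ such that: (1) if $(a,b)\in M_s$ for some $1\le s\le k$, then $\varphi(a)=\varphi(b)$; (2) if $(a,b)\notin M_s$ for every $1\le s\le k$, and $\langle\partial a,b\rangle\neq 0$, then $\varphi(b)>\varphi(a)$. Then $M$ is acyclic.
   Context: With respect to the bases $B_i$, write $\partial(b_i^j)=\sum_h\langle\partial b_i^j,b_{i+1}^h\rangle\, b_{i+1}^h$ with coefficients $\langle\partial b_i^j,b_{i+1}^h\rangle\in\mathbb{K}$. The directed graph associated to $(C_*,\partial_* )$ and these bases has vertex set $\bigcup_iB_i$ and a directed edge $(b_i^j,b_{i+1}^h)$ exactly when $\langle\partial b_i^j,b_{i+1}^h\rangle\neq0$. A matching on a directed graph is a subset of pairwise disjoint edges (no two share a vertex); it is acyclic if the directed graph obtained by inverting the orientation of the edges in the matching has no directed cycles. A (acyclic) matching on $(C_*,\partial_* )$ is a (acyclic) matching on the associated directed graph. *)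

theory Defs
  imports "Graph_Theory.Pair_Digraph" "HOL-Library.Disjoint_Sets"
begin

text \<open>
  The scalar field is the type \<open>'k\<close>.  The spaces \<open>C i\<close> are subspaces of one ambient
  vector space, which can be taken to be the direct sum of the terms; they are not required to
  intersect trivially.  The differential \<open>d i\<close> only matters on \<open>C i\<close>.
\<close>

locale fg_chain_complex = vector_space scale
  for scale :: "'k::field \<Rightarrow> 'v::ab_group_add \<Rightarrow> 'v" +
  fixes C :: "int \<Rightarrow> 'v set"
    and d :: "int \<Rightarrow> 'v \<Rightarrow> 'v"
  assumes subspace_C: "subspace (C i)"
    and fin_gen: "\<exists>S. finite S \<and> span S = C i"
    and d_in: "x \<in> C i \<Longrightarrow> d i x \<in> C (i + 1)"
    and d_add: "x \<in> C i \<Longrightarrow> y \<in> C i \<Longrightarrow> d i (x + y) = d i x + d i y"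
    and d_scale: "x \<in> C i \<Longrightarrow> d i (scale c x) = scale c (d i x)"
    and d_d: "x \<in> C i \<Longrightarrow> d (i + 1) (d i x) = 0"

definition finite_basis_of ::
  "('k::field \<Rightarrow> 'v::ab_group_add \<Rightarrow> 'v) \<Rightarrow> 'v set \<Rightarrow> 'v set \<Rightarrow> bool" where
  "finite_basis_of scale B V \<longleftrightarrow>
    finite B \<and> \<not> module.dependent scale B \<and> module.span scale B = V"

text \<open>
  \<open>incidence scale B d i a b\<close> is the coefficient of \<open>b \<in> B (i + 1)\<close> in \<open>d i a\<close>, for \<open>a \<in> B i\<close>.
\<close>

definition incidence ::
  "('k::field \<Rightarrow> 'v::ab_group_add \<Rightarrow> 'v) \<Rightarrow> (int \<Rightarrow> 'v set) \<Rightarrow> (int \<Rightarrow> 'v \<Rightarrow> 'v) \<Rightarrow>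
    int \<Rightarrow> 'v \<Rightarrow> 'v \<Rightarrow> 'k" where
  "incidence scale B d i a b = module.representation scale (B (i + 1)) (d i a) b"

text \<open>
  The union of the bases is a disjoint one, so a vertex is a pair of a degree and a basis vector:
  the same ambient vector may be a basis element in several degrees.
\<close>

definition complex_digraph ::
  "('k::field \<Rightarrow> 'v::ab_group_add \<Rightarrow> 'v) \<Rightarrow> (int \<Rightarrow> 'v set) \<Rightarrow> (int \<Rightarrow> 'v \<Rightarrow> 'v) \<Rightarrow>
    (int \<times> 'v) pair_pre_digraph" where
  "complex_digraph scale B d =
    \<lparr> pverts = (SIGMA i:UNIV. B i),
      parcs = {((i, a), (i + 1, b)) | i a b.
                 a \<in> B i \<and> b \<in> B (i + 1) \<and> incidence scale B d i a b \<noteq> 0} \<rparr>"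

definition matching :: "'a pair_pre_digraph \<Rightarrow> 'a rel \<Rightarrow> bool" where
  "matching G M \<longleftrightarrow>
    M \<subseteq> parcs G \<and> pairwise (\<lambda>e f. {fst e, snd e} \<inter> {fst f, snd f} = {}) M"

definition invert_arcs :: "'a pair_pre_digraph \<Rightarrow> 'a rel \<Rightarrow> 'a pair_pre_digraph" where
  "invert_arcs G M = G \<lparr> parcs := (parcs G - M) \<union> M\<inverse> \<rparr>"

definition acyclic_matching :: "'a pair_pre_digraph \<Rightarrow> 'a rel \<Rightarrow> bool" where
  "acyclic_matching G M \<longleftrightarrow>
    matching G M \<and> (\<nexists>p. pre_digraph.cycle (with_proj (invert_arcs G M)) p)"

end

theory Submission
  imports Defs
begin

text \<open>
  The matched arcs preserve \<open>\<phi>\<close> and the unmatched arcs increase it.  Inverting the matched arcs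
  therefore leaves a digraph in which \<open>\<phi>\<close> never decreases along an arc.  On a directed cycle \<open>\<phi>\<close>
  has to be constant, so the cycle can only consist of inverted arcs; but each of these lowers the
  degree by one, so they cannot close up.

  The two steps are merged into one by ordering the vertices lexicographically, by increasing
  \<open>\<phi>\<close> and then by decreasing degree: every arc of the inverted digraph goes strictly up in this
  order (\<open>arc_invert_arcs_ascends\<close>), and a digraph whose arcs go up in a strict order has
  no cycle (\<open>no_cycle_if_arcs_ascend\<close>).
\<close>

lemma (in pre_digraph) cas_imp_ascends:
  assumes "trans r" and "\<And>e. e \<in> arcs G \<Longrightarrow> (tail G e, head G e) \<in> r"
    and "cas u p v" and "set p \<subseteq> arcs G" and "p \<noteq> []"
  shows "(u, v) \<in> r"
  using assms(3-5)
proof (induction p arbitrary: u)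
  case Nil
  then show ?case by simp
next
  case (Cons e p)
  then have e: "(u, head G e) \<in> r" and p: "cas (head G e) p v"
    using assms(2) by auto
  show ?case
  proof (cases "p = []")
    case True
    then show ?thesis using e p by simp
  next
    case False
    then have "(head G e, v) \<in> r" using Cons p by auto
    with e show ?thesis using \<open>trans r\<close> by (blast dest: transD)
  qed
qed

lemma (in pre_digraph) no_cycle_if_arcs_ascend:
  assumes "trans r" and "irrefl r" and "\<And>e. e \<in> arcs G \<Longrightarrow> (tail G e, head G e) \<in> r"
  shows "\<not> cycle p"
proof
  assume "cycle p"
  then obtain u where "cas u p u" "set p \<subseteq> arcs G" "p \<noteq> []"
    by (auto simp: cycle_def awalk_def)
  then have "(u, u) \<in> r" using cas_imp_ascends[OF assms(1,3)] by simp
  then show False using \<open>irrefl r\<close> by (auto simp: irrefl_def)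
qed

definition potential_order :: "(int \<times> 'v \<Rightarrow> nat) \<Rightarrow> (int \<times> 'v) rel" where
  "potential_order \<phi> = {(x, y). \<phi> x < \<phi> y \<or> \<phi> x = \<phi> y \<and> fst y < fst x}"

lemma trans_potential_order: "trans (potential_order \<phi>)"
  by (auto simp: potential_order_def intro!: transI)

lemma irrefl_potential_order: "irrefl (potential_order \<phi>)"
  by (auto simp: potential_order_def irrefl_def)

text \<open>
  Decreasing degree is the right tie-breaker because the arcs that preserve \<open>\<phi>\<close> are the
  matched ones, which lead from degree \<open>i + 1\<close> to degree \<open>i\<close> once they are inverted.
\<close>

lemma arc_invert_arcs_ascends:
  assumes "M \<subseteq> parcs (complex_digraph scale B d)"
    and "\<And>a b. (a, b) \<in> M \<Longrightarrow> \<phi> a = \<phi> b"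
    and "\<And>i a b. a \<in> B i \<Longrightarrow> b \<in> B (i + 1) \<Longrightarrow> ((i, a), (i + 1, b)) \<notin> M \<Longrightarrow>
           incidence scale B d i a b \<noteq> 0 \<Longrightarrow> \<phi> (i, a) < \<phi> (i + 1, b)"
    and "e \<in> parcs (invert_arcs (complex_digraph scale B d) M)"
  shows "e \<in> potential_order \<phi>"
proof -
  consider "e \<in> parcs (complex_digraph scale B d)" "e \<notin> M" | "e \<in> M\<inverse>"
    using assms(4) by (auto simp: invert_arcs_def)
  then show ?thesis
  proof cases
    case 1
    then show ?thesis using assms(3) by (auto simp: complex_digraph_def potential_order_def)
  next
    case 2
    then obtain x y where e: "e = (y, x)" "(x, y) \<in> M" by auto
    then have "fst y = fst x + 1"
      using assms(1) by (auto simp: complex_digraph_def)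
    then show ?thesis using e assms(2)[of x y] by (simp add: potential_order_def)
  qed
qed

theorem lemma4p11:
  fixes scale :: "'k::field \<Rightarrow> 'v::ab_group_add \<Rightarrow> 'v"
    and C :: "int \<Rightarrow> 'v set"
    and d :: "int \<Rightarrow> 'v \<Rightarrow> 'v"
    and B :: "int \<Rightarrow> 'v set"
    and G :: "(int \<times> 'v) pair_pre_digraph"
    and M :: "(int \<times> 'v) rel"
    and Ms :: "nat \<Rightarrow> (int \<times> 'v) rel"
    and k :: nat
    and \<phi> :: "int \<times> 'v \<Rightarrow> nat"
  assumes "fg_chain_complex scale C d"
    and "\<And>i. finite_basis_of scale (B i) (C i)"
    and "G = complex_digraph scale B d"
    and "matching G M"
    and "M = (\<Union>s\<in>{1..k}. Ms s)"
    and "disjoint_family_on Ms {1..k}"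
    and "\<And>s. s \<in> {1..k} \<Longrightarrow> acyclic_matching G (Ms s)"
    and "\<And>s a b. s \<in> {1..k} \<Longrightarrow> (a, b) \<in> Ms s \<Longrightarrow> \<phi> a = \<phi> b"
    and "\<And>i a b. a \<in> B i \<Longrightarrow> b \<in> B (i + 1) \<Longrightarrow>
           (\<forall>s\<in>{1..k}. ((i, a), (i + 1, b)) \<notin> Ms s) \<Longrightarrow>
           incidence scale B d i a b \<noteq> 0 \<Longrightarrow> \<phi> (i + 1, b) > \<phi> (i, a)"
  shows "acyclic_matching G M"
proof -
  have "M \<subseteq> parcs (complex_digraph scale B d)"
    using assms(3,4) by (simp add: matching_def)
  moreover have "\<phi> a = \<phi> b" if "(a, b) \<in> M" for a b
    using that assms(5,8) by blast
  moreover have "\<phi> (i, a) < \<phi> (i + 1, b)"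
    if "a \<in> B i" "b \<in> B (i + 1)" "((i, a), (i + 1, b)) \<notin> M" "incidence scale B d i a b \<noteq> 0"
    for i a b
    using that assms(5,9) by blast
  ultimately have "e \<in> potential_order \<phi>" if "e \<in> parcs (invert_arcs G M)" for e
    using arc_invert_arcs_ascends[of M scale B d \<phi> e] that unfolding assms(3) by simp
  then have "\<not> pre_digraph.cycle (with_proj (invert_arcs G M)) p" for p
    by (intro pre_digraph.no_cycle_if_arcs_ascend[OF trans_potential_order[of \<phi>]
          irrefl_potential_order]) simp
  then show ?thesis using assms(4) by (simp add: acyclic_matching_def)
qed

end
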